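(* Let $\mathbb{O}$ be a finite set of $K\ge 2$ objects, let $\mathbb{D}=\{\pi_1,\dots,\pi_N\}$, $N\ge 1$, be a database of (possibly incomplete) rankings over $\mathbb{O}$, and let $\delta>0$ be a support threshold. Then the algorithm TESMA (described in the context) is correct: every order found by TESMA is frequent, and every frequent order is found by TESMA.
   Context: An (incomplete) ranking or order over $\mathbb{O}$ is a total order of a subset of at least two objects, written as a sequence $\rho=(o_{i_1},\dots,o_{i_k})$ of pairwise distinct objects, $2\le k\le K$, meaning $o_{i_1}\succ o_{i_2}\succ\dots\succ o_{i_k}$ (first = top position); $k$ is its length, $O(\rho)=\{o_{i_1},\dots,o_{i_k}\}$, and $last(\rho)=o_{i_k}$. ("Ranking" and "order" are identified via the bijection between position functions and sequences.) Write $\rho\subset\rho'$ ($\rho$ is a subranking of $\rho'$) if $O(\rho)\subseteq O(\rho')$ and $\rho'$ puts the objects of $O(\rho)$ in the same relative order as $\rho$. The members of $\mathbb{D}$ are called transactions. For a ranking $\rho$, $g(\rho)=\{\pi_i\in\mathbb{D} : \rho\subset\pi_i\}$ is the set of transactions containing it, and $\operatorname{supp}(\rho)=\#g(\rho)/N$. A ranking $\rho$ is frequent if $\operatorname{supp}(\rho)\ge\delta$. For an object $o\notin O(\rho)$, the tail extension $\rho\,|\,o$ is the order obtained from $\rho$ by appending $o$ at the last position. Algorithm TESMA: (1) Compute all frequent rankings of length 2, together with their sets $g((o_i,o_j))$; all of these are found (output). (2) For each frequent 2-ranking, start a depth-first recursion: given a found order $\rho$ with known set $g(\rho)$, consider each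 object $o$ such that $(last(\rho),o)$ is a frequent 2-ranking, and compute $T=g(\rho)\cap g((last(\rho),o))$. If $\#T/N\ge\delta$, then $\rho\,|\,o$ is found (output), $T$ is recorded as the set of transactions $g(\rho\,|\,o)$, and the recursion continues with $\rho\,|\,o$; otherwise this branch is pruned. *)

theory Defs
  imports Complex_Main
begin

text \<open>
  Orders are lists, first element = top position. The set \<open>Ob\<close> is the set of objects. The database
  is the family \<open>\<pi> 1, \<dots>, \<pi> N\<close>; a transaction is represented by its index, so that the same ranking
  may occur in several transactions and is then counted with multiplicity.
\<close>

definition ranking :: "'a set \<Rightarrow> 'a list \<Rightarrow> bool" where
  "ranking Ob \<rho> \<longleftrightarrow> distinct \<rho> \<and> set \<rho> \<subseteq> Ob \<and> 2 \<le> length \<rho> \<and> length \<rho> \<le> card Ob"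

definition prefers :: "'a list \<Rightarrow> 'a \<Rightarrow> 'a \<Rightarrow> bool" where
  "prefers \<rho> x y \<longleftrightarrow> (\<exists>i j. i < j \<and> j < length \<rho> \<and> \<rho> ! i = x \<and> \<rho> ! j = y)"

definition subranking :: "'a list \<Rightarrow> 'a list \<Rightarrow> bool" where
  "subranking \<rho> \<rho>' \<longleftrightarrow>
     set \<rho> \<subseteq> set \<rho>' \<and> (\<forall>x\<in>set \<rho>. \<forall>y\<in>set \<rho>. prefers \<rho> x y \<longleftrightarrow> prefers \<rho>' x y)"

definition g :: "nat \<Rightarrow> (nat \<Rightarrow> 'a list) \<Rightarrow> 'a list \<Rightarrow> nat set" where
  "g N \<pi> \<rho> = {i \<in> {1..N}. subranking \<rho> (\<pi> i)}"

definition supp :: "nat \<Rightarrow> (nat \<Rightarrow> 'a list) \<Rightarrow> 'a list \<Rightarrow> real" where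
  "supp N \<pi> \<rho> = real (card (g N \<pi> \<rho>)) / real N"

definition frequent :: "'a set \<Rightarrow> nat \<Rightarrow> (nat \<Rightarrow> 'a list) \<Rightarrow> real \<Rightarrow> 'a list \<Rightarrow> bool" where
  "frequent Ob N \<pi> \<delta> \<rho> \<longleftrightarrow> ranking Ob \<rho> \<and> supp N \<pi> \<rho> \<ge> \<delta>"

text \<open>
  \<open>tesma Ob N \<pi> \<delta> \<rho> T\<close>: a run of TESMA outputs \<open>\<rho>\<close> and records \<open>T\<close> as its set of transactions.
  The step rule works with the recorded set \<open>T\<close> and never recomputes \<open>g N \<pi> \<rho>\<close>. As in the algorithm,
  it does not test whether the appended object already occurs in \<open>\<rho>\<close>, so that the absence of
  repetitions in the output is something to be proved.
\<close>

inductive tesma ::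
  "'a set \<Rightarrow> nat \<Rightarrow> (nat \<Rightarrow> 'a list) \<Rightarrow> real \<Rightarrow> 'a list \<Rightarrow> nat set \<Rightarrow> bool"
  for Ob :: "'a set" and N :: nat and \<pi> :: "nat \<Rightarrow> 'a list" and \<delta> :: real
where
  pair: "frequent Ob N \<pi> \<delta> [a, b] \<Longrightarrow> tesma Ob N \<pi> \<delta> [a, b] (g N \<pi> [a, b])"
| extend: "\<lbrakk>tesma Ob N \<pi> \<delta> \<rho> T; frequent Ob N \<pi> \<delta> [last \<rho>, b];
     T' = T \<inter> g N \<pi> [last \<rho>, b]; real (card T') / real N \<ge> \<delta>\<rbrakk>
     \<Longrightarrow> tesma Ob N \<pi> \<delta> (\<rho> @ [b]) T'"

definition found :: "'a set \<Rightarrow> nat \<Rightarrow> (nat \<Rightarrow> 'a list) \<Rightarrow> real \<Rightarrow> 'a list \<Rightarrow> bool" where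
  "found Ob N \<pi> \<delta> \<rho> \<longleftrightarrow> (\<exists>T. tesma Ob N \<pi> \<delta> \<rho> T)"

end

(* Inside a fixed ranking p, "preferred to" is a strict order, so by transitivity a list is a
   subranking of p as soon as its consecutive pairs are in the right order. Hence
   g(\<rho> | o) = g(\<rho>) \<inter> g((last(\<rho>), o)), which makes the recorded transaction sets correct. An
   extension with positive support is contained in some transaction, so by irreflexivity
   of the order it has no repetitions. *)
theory Submission
  imports Defs
begin

text \<open>As \<open>p\<close> has no repetitions, the middle object occupies a single position, so
  the two pairs of positions can be chained.\<close>

lemma transp_prefers:
  assumes "distinct p"
  shows "transp (prefers p)"
proof (rule transpI)
  fix x y z assume "prefers p x y" "prefers p y z"
  then obtain i j k l where *: "i < j" "j < length p" "p ! i = x" "p ! j = y"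
    "k < l" "l < length p" "p ! k = y" "p ! l = z"
    unfolding prefers_def by blast
  with assms have "j = k"
    by (metis nth_eq_iff_index_eq order.strict_trans)
  with * show "prefers p x z"
    unfolding prefers_def by (metis order.strict_trans)
qed

lemma prefers_irrefl:
  assumes "distinct p"
  shows "\<not> prefers p x x"
  using assms unfolding prefers_def
  by (metis nat_neq_iff nth_eq_iff_index_eq order.strict_trans)

lemma prefers_in_set:
  assumes "prefers p x y"
  shows "x \<in> set p" and "y \<in> set p"
  using assms unfolding prefers_def by auto

text \<open>A repeated object would have to be preferred to itself in \<open>p\<close>.\<close>

lemma sorted_wrt_prefers_distinct:
  assumes "distinct p" and "sorted_wrt (prefers p) \<rho>"
  shows "distinct \<rho>"
  using assms(2) by (induction \<rho>) (use prefers_irrefl[OF assms(1)] in auto)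

text \<open>The converse works because \<open>prefers p\<close> is asymmetric: it cannot order two
  entries of \<open>\<rho>\<close> against their positions. The length bound excludes singletons,
  for which sortedness is vacuous and does not place the object in \<open>p\<close>.\<close>

lemma subranking_iff_sorted_wrt:
  assumes p: "distinct p" and \<rho>: "distinct \<rho>" and len: "2 \<le> length \<rho>"
  shows "subranking \<rho> p \<longleftrightarrow> sorted_wrt (prefers p) \<rho>"
proof
  assume sub: "subranking \<rho> p"
  show "sorted_wrt (prefers p) \<rho>"
    unfolding sorted_wrt_iff_nth_less
  proof (intro allI impI)
    fix i j assume ij: "i < j" "j < length \<rho>"
    then have "prefers \<rho> (\<rho> ! i) (\<rho> ! j)"
      unfolding prefers_def by blast
    moreover have "\<rho> ! i \<in> set \<rho>" "\<rho> ! j \<in> set \<rho>"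
      using ij by auto
    ultimately show "prefers p (\<rho> ! i) (\<rho> ! j)"
      using sub unfolding subranking_def by blast
  qed
next
  assume sorted: "sorted_wrt (prefers p) \<rho>"
  have nth: "prefers p (\<rho> ! i) (\<rho> ! j)" if "i < j" "j < length \<rho>" for i j
    using sorted that by (simp add: sorted_wrt_iff_nth_less)
  have "\<rho> ! i \<in> set p" if "i < length \<rho>" for i
  \<comment> \<open>Membership in \<open>p\<close> comes from being compared with some other entry:
    position 0 is compared with position 1, every later position with 0.\<close>
  proof (cases i)
    case 0
    then show ?thesis using nth[of 0 1] len prefers_in_set(1) by force
  next
    case (Suc k)
    then show ?thesis using nth[of 0 i] that prefers_in_set(2) by force
  qed
  then have "set \<rho> \<subseteq> set p"
    by (auto simp: in_set_conv_nth)
  moreover have "prefers \<rho> x y \<longleftrightarrow> prefers p x y" if xy: "x \<in> set \<rho>" "y \<in> set \<rho>" for x y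
  proof
    assume "prefers \<rho> x y"
    then show "prefers p x y"
      using nth unfolding prefers_def[of \<rho>] by blast
  next
    assume pref: "prefers p x y"
    obtain i j where ij: "i < length \<rho>" "\<rho> ! i = x" "j < length \<rho>" "\<rho> ! j = y"
      using xy by (metis in_set_conv_nth)
    have "\<not> prefers p y x"
      using pref transp_prefers[OF p] prefers_irrefl[OF p] by (metis transpD)
    \<comment> \<open>Equality of positions would contradict irreflexivity, and \<open>j < i\<close>
      would give \<open>prefers p y x\<close> by \<open>nth\<close>.\<close>
    then have "i < j"
      using ij nth pref prefers_irrefl[OF p] by (metis nat_neq_iff)
    then show "prefers \<rho> x y"
      using ij unfolding prefers_def by blast
  qed
  ultimately show "subranking \<rho> p"
    unfolding subranking_def by blast
qed

text \<open>Transitivity reduces all pairs to consecutive ones. Having \<open>distinct\<close> on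
  the left lets distinctness be derived from a chain of comparisons.\<close>

lemma distinct_subranking_iff_successively:
  assumes "distinct p" and "2 \<le> length \<rho>"
  shows "distinct \<rho> \<and> subranking \<rho> p \<longleftrightarrow> successively (prefers p) \<rho>"
  using subranking_iff_sorted_wrt[OF assms(1) _ assms(2)] sorted_wrt_prefers_distinct[OF assms(1)]
    successively_conv_sorted_wrt[OF transp_prefers[OF assms(1)]]
  by blast

text \<open>Appending \<open>b\<close> adds just one consecutive pair. Right to left, this gives
  both the containment and the absence of repetitions in the extended order.\<close>

lemma distinct_subranking_snoc_iff:
  assumes "distinct p" and "2 \<le> length \<rho>"
  shows "distinct (\<rho> @ [b]) \<and> subranking (\<rho> @ [b]) p \<longleftrightarrow>
    (distinct \<rho> \<and> subranking \<rho> p) \<and> (distinct [last \<rho>, b] \<and> subranking [last \<rho>, b] p)"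
proof -
  have "\<rho> \<noteq> []" using assms(2) by auto
  then have "successively (prefers p) (\<rho> @ [b]) \<longleftrightarrow>
      successively (prefers p) \<rho> \<and> successively (prefers p) [last \<rho>, b]"
    by (simp add: successively_append_iff)
  moreover have "2 \<le> length (\<rho> @ [b])" "2 \<le> length [last \<rho>, b]"
    using assms(2) by simp_all
  ultimately show ?thesis
    using assms distinct_subranking_iff_successively by metis
qed

lemma g_snoc:
  assumes "\<And>i. i \<in> {1..N} \<Longrightarrow> distinct (\<pi> i)"
    and "2 \<le> length \<rho>" and "distinct (\<rho> @ [b])"
  shows "g N \<pi> (\<rho> @ [b]) = g N \<pi> \<rho> \<inter> g N \<pi> [last \<rho>, b]"
proof -
  have "last \<rho> \<in> set \<rho>"
    using assms(2) by (intro last_in_set) auto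
  then have "distinct \<rho>" "distinct [last \<rho>, b]"
    using assms(3) by auto
  then have "subranking (\<rho> @ [b]) (\<pi> i) \<longleftrightarrow> subranking \<rho> (\<pi> i) \<and> subranking [last \<rho>, b] (\<pi> i)"
    if "i \<in> {1..N}" for i
    using distinct_subranking_snoc_iff[OF assms(1)[OF that] assms(2), of b] assms(3) by blast
  then show ?thesis
    unfolding g_def by blast
qed

lemma frequent_if_g_subset:
  assumes "frequent Ob N \<pi> \<delta> \<rho>" and "g N \<pi> \<rho> \<subseteq> g N \<pi> \<sigma>" and "ranking Ob \<sigma>"
  shows "frequent Ob N \<pi> \<delta> \<sigma>"
proof -
  have "finite (g N \<pi> \<sigma>)"
    unfolding g_def by simp
  then have "supp N \<pi> \<rho> \<le> supp N \<pi> \<sigma>"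
    using card_mono[OF _ assms(2)] unfolding supp_def by (simp add: divide_right_mono)
  then show ?thesis
    using assms(1,3) unfolding frequent_def by simp
qed

text \<open>The equation for \<open>T\<close> is the invariant that carries the induction: the
  threshold test on the recorded set thereby becomes a test of the true support.\<close>

lemma tesma_sound:
  assumes "finite Ob" and \<pi>: "\<And>i. i \<in> {1..N} \<Longrightarrow> distinct (\<pi> i)" and "\<delta> > 0"
    and "tesma Ob N \<pi> \<delta> \<rho> T"
  shows "frequent Ob N \<pi> \<delta> \<rho> \<and> T = g N \<pi> \<rho>"
  using assms(4)
proof (induction rule: tesma.induct)
  case (pair a b)
  then show ?case by simp
next
  case (extend \<rho> T b T')
  then have \<rho>: "distinct \<rho>" "set \<rho> \<subseteq> Ob" "2 \<le> length \<rho>" and T: "T = g N \<pi> \<rho>"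
    and b: "b \<in> Ob" "distinct [last \<rho>, b]"
    by (auto simp: frequent_def ranking_def)
  \<comment> \<open>An empty \<open>T'\<close> would have ratio 0, below the positive threshold. Any
    transaction in \<open>T'\<close> then serves as a witness that \<open>b\<close> does not occur
    in \<open>\<rho>\<close>.\<close>
  have "card T' \<noteq> 0"
    using \<open>real (card T') / real N \<ge> \<delta>\<close> \<open>\<delta> > 0\<close> by (intro notI) simp
  then obtain i where "i \<in> T'"
    by fastforce
  then have "i \<in> {1..N}" "subranking \<rho> (\<pi> i)" "subranking [last \<rho>, b] (\<pi> i)"
    using extend.hyps T unfolding g_def by auto
  then have dist: "distinct (\<rho> @ [b])"
    using distinct_subranking_snoc_iff[OF \<pi> \<rho>(3)] \<rho>(1) b(2) by blast
  have sub: "set (\<rho> @ [b]) \<subseteq> Ob"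
    using \<rho> b by simp
  then have "length (\<rho> @ [b]) \<le> card Ob"
    using dist distinct_card[OF dist] card_mono[OF \<open>finite Ob\<close> sub] by linarith
  then have "ranking Ob (\<rho> @ [b])"
    unfolding ranking_def using dist sub \<rho>(3) by simp
  moreover have "T' = g N \<pi> (\<rho> @ [b])"
    using g_snoc[OF \<pi> \<rho>(3) dist] extend.hyps T by simp
  ultimately show ?case
    using extend.hyps unfolding frequent_def supp_def by simp
qed

text \<open>Induction from the tail mirrors the recursion of the algorithm; naming the recorded set
  provides the \<open>T\<close> required by the extension rule.\<close>

lemma tesma_complete:
  assumes \<pi>: "\<And>i. i \<in> {1..N} \<Longrightarrow> distinct (\<pi> i)" and "frequent Ob N \<pi> \<delta> \<rho>"
  shows "tesma Ob N \<pi> \<delta> \<rho> (g N \<pi> \<rho>)"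
  using assms(2)
proof (induction \<rho> rule: rev_induct)
  case Nil
  then show ?case by (simp add: frequent_def ranking_def)
next
  case (snoc b \<rho>)
  from snoc.prems have r: "distinct (\<rho> @ [b])" "set (\<rho> @ [b]) \<subseteq> Ob"
    "2 \<le> length (\<rho> @ [b])" "length (\<rho> @ [b]) \<le> card Ob"
    unfolding frequent_def ranking_def by auto
  show ?case
  proof (cases "2 \<le> length \<rho>")
    case False
    then have "length \<rho> = 1"
      using r(3) by simp
    then obtain a where "\<rho> = [a]"
      by (auto simp: length_Suc_conv)
    then show ?thesis
      using snoc.prems by (simp add: tesma.pair)
  next
    case True
    then have "last \<rho> \<in> set \<rho>"
      by (intro last_in_set) auto
    then have rank: "ranking Ob \<rho>" "ranking Ob [last \<rho>, b]"
      using r True unfolding ranking_def by auto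
    have g: "g N \<pi> (\<rho> @ [b]) = g N \<pi> \<rho> \<inter> g N \<pi> [last \<rho>, b]"
      using g_snoc[OF \<pi> True r(1)] .
    \<comment> \<open>Support is antimonotone: both sets on the right of \<open>g\<close> contain
      the set of the longer order, so no branch leading to a frequent order is pruned.\<close>
    then have "frequent Ob N \<pi> \<delta> \<rho>" and pair: "frequent Ob N \<pi> \<delta> [last \<rho>, b]"
      using frequent_if_g_subset[OF snoc.prems] rank by auto
    then have "tesma Ob N \<pi> \<delta> \<rho> (g N \<pi> \<rho>)"
      using snoc.IH by blast
    then show ?thesis
      using tesma.extend[OF _ pair g] snoc.prems by (simp add: frequent_def supp_def)
  qed
qed

theorem mainTheorem1:
  fixes Ob :: "'a set" and N :: nat and \<pi> :: "nat \<Rightarrow> 'a list" and \<delta> :: real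
  assumes "finite Ob" and "card Ob \<ge> 2"
    and "N \<ge> 1" and "\<And>i. i \<in> {1..N} \<Longrightarrow> ranking Ob (\<pi> i)"
    and "\<delta> > 0"
  shows "(\<forall>\<rho>. found Ob N \<pi> \<delta> \<rho> \<longrightarrow> frequent Ob N \<pi> \<delta> \<rho>) \<and>
         (\<forall>\<rho>. frequent Ob N \<pi> \<delta> \<rho> \<longrightarrow> found Ob N \<pi> \<delta> \<rho>)"
proof -
  have "distinct (\<pi> i)" if "i \<in> {1..N}" for i
    using assms(4)[OF that] by (simp add: ranking_def)
  then show ?thesis
    using tesma_sound[OF assms(1) _ assms(5)] tesma_complete unfolding found_def by metis
qed

end
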